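(* Let $p$ be a prime, let $F$ be a field containing a primitive $p$-th root of unity $\xi$, and let $a,b,c\in F^\times$ be such that $\chi_a\cup\chi_b=0=\chi_b\cup\chi_c$ in $H^2(G_F,\mathbb{Z}/p\mathbb{Z})$, $a$ and $c$ are linearly independent modulo $(F^\times)^p$, and $a$ and $b$ are linearly independent modulo $(F^\times)^p$. Let $E=F(\sqrt[p]{a},\sqrt[p]{c})$ and $G=\mathrm{Gal}(E/F)=\langle\sigma_a,\sigma_c\rangle$. Let $\alpha\in F(\sqrt[p]{a})$ and $\gamma\in F(\sqrt[p]{c})$ satisfy $N_{F(\sqrt[p]{a})/F}(\alpha)=b=N_{F(\sqrt[p]{c})/F}(\gamma)$, and put $$A_0=\prod_{i=0}^{p-2}\sigma_a^{i}(\alpha^{p-i-1}),\qquad C_0=\prod_{i=0}^{p-2}\sigma_c^{i}(\gamma^{p-i-1}),\qquad B=\gamma/\alpha.$$ Then there exist $f_a,f_c\in F^\times$ such that $(f_aA_0,B,f_cC_0)$ is a coboundary, i.e. lies in $B^2(G,E^\times)$.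
   Context: $G_F$ is the absolute Galois group of $F$. For $x\in F^\times$, $\chi_x\in\mathrm{Hom}(G_F,\mathbb{Z}/p\mathbb{Z})=H^1(G_F,\mathbb{Z}/p\mathbb{Z})$ is the Kummer character, $\sigma(\sqrt[p]{x})=\xi^{\chi_x(\sigma)}\sqrt[p]{x}$. "Linearly independent modulo $(F^\times)^p$" means linearly independent in the $\mathbb{F}_p$-vector space $F^\times/(F^\times)^p$. The generators of $G$ are determined by $\sigma_a(\sqrt[p]{a})=\xi\sqrt[p]{a}$, $\sigma_a(\sqrt[p]{c})=\sqrt[p]{c}$, $\sigma_c(\sqrt[p]{c})=\xi\sqrt[p]{c}$, $\sigma_c(\sqrt[p]{a})=\sqrt[p]{a}$. For $\sigma\in G$ of order $p$ and $x\in E^\times$, $N_\sigma(x)=\prod_{i=0}^{p-1}\sigma^i(x)$. The group of 2-coboundaries (in the presentation of the cohomology of the bicyclic group $G=\langle\sigma_a\rangle\times\langle\sigma_c\rangle$), written multiplicatively, is $$B^2(G,E^\times)=\Big\{(x,y,z)\in(E^\times)^3 \;\Big|\; \exists\, C_1,C_2\in E^\times:\ x=N_{\sigma_c}(C_1),\ y=\frac{\sigma_a(C_1)}{C_1}\cdot\frac{C_2}{\sigma_c(C_2)},\ z=N_{\sigma_a}(C_2)\Big\}.$$ *)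

theory Defs
  imports
    "HOL-Algebra.Algebraic_Closure_Type"
    "HOL-Algebra.Generated_Fields"
    "HOL-Algebra.Bij"
    "HOL-Algebra.Coset"
    "HOL-Number_Theory.Residues"
    "HOL-Analysis.Product_Topology"
begin

text \<open>
  The base field \<open>F\<close> is a type \<open>'a\<close> of class \<^class>\<open>field\<close>. All algebraic extensions of
  \<open>F\<close> live as subsets of the library's algebraic closure of \<open>'a\<close>, in which \<open>F\<close> is embedded by
  \<^const>\<open>to_ac\<close>.
\<close>

abbreviation base_field :: "'a::field alg_closure set" where
  "base_field \<equiv> range to_ac"

definition adjoin :: "'k::field set \<Rightarrow> 'k set \<Rightarrow> 'k set" where
  "adjoin F S = generate_field ring_of_type_algebra (F \<union> S)"


section \<open>Galois groups\<close>

text \<open>Functions on a subfield \<open>K\<close> are extensional, i.e. undefined outside of \<open>K\<close>.\<close>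

definition embeddings :: "'k::field set \<Rightarrow> 'k set \<Rightarrow> ('k \<Rightarrow> 'k) set" where
  "embeddings F K =
     {\<sigma> \<in> extensional K.
        \<sigma> \<in> ring_hom (ring_of_type_algebra\<lparr>carrier := K\<rparr>) ring_of_type_algebra \<and>
        (\<forall>x\<in>F. \<sigma> x = x)}"

definition galois_group :: "'k::field set \<Rightarrow> 'k set \<Rightarrow> ('k \<Rightarrow> 'k) monoid" where
  "galois_group F K = (BijGroup K)\<lparr>carrier := Bij K \<inter> embeddings F K\<rparr>"

text \<open>
  The Krull topology has as a basis the cosets of the subgroups \<open>Gal(K/L)\<close> with \<open>L\<close> a finite
  subextension of \<open>K/F\<close>; as \<open>K/F\<close> is algebraic, these are the \<open>L = F(S)\<close> with \<open>S\<close> finite.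
\<close>

definition krull_topology :: "'k::field set \<Rightarrow> 'k set \<Rightarrow> ('k \<Rightarrow> 'k) topology" where
  "krull_topology F K =
     topology_generated_by
       {{\<tau> \<in> carrier (galois_group F K). \<forall>x \<in> adjoin F S. \<tau> x = \<sigma> x} | \<sigma> S.
          \<sigma> \<in> carrier (galois_group F K) \<and> finite S \<and> S \<subseteq> K}"

text \<open>
  An element is separable over \<open>F\<close> if its minimal polynomial (up to a scalar, the irreducible
  polynomial over \<open>F\<close> that it is a root of) has only simple roots in the algebraic closure.
\<close>

definition separable_closure :: "'a::field alg_closure set" where
  "separable_closure =
     {x. \<exists>q :: 'a poly. irreducible q \<and> poly (map_poly to_ac q) x = 0 \<and>
                        rsquarefree (map_poly to_ac q)}"

definition abs_galois_group :: "('a::field alg_closure \<Rightarrow> 'a alg_closure) monoid" where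
  "abs_galois_group = galois_group base_field separable_closure"

definition abs_krull_topology :: "('a::field alg_closure \<Rightarrow> 'a alg_closure) topology" where
  "abs_krull_topology = krull_topology base_field separable_closure"

text \<open>
  The norm of a finite separable extension \<open>K/F\<close>, as the product of all conjugates. The
  ambient field \<open>'k\<close> must be an algebraic closure of \<open>F\<close> (so that there are \<open>[K : F]\<close> embeddings).
\<close>

definition field_norm :: "'k::field set \<Rightarrow> 'k set \<Rightarrow> 'k \<Rightarrow> 'k" where
  "field_norm F K x = (\<Prod>\<sigma>\<in>embeddings F K. \<sigma> x)"


section \<open>Continuous cohomology in degree 2 with trivial action\<close>

text \<open>
  \<open>G\<close> is a topological group with topology \<open>T\<close> on its carrier, and the coefficients are a
  discrete ring \<open>A\<close> on which \<open>G\<close> acts trivially.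
\<close>

definition cochains :: "'x topology \<Rightarrow> 'r ring \<Rightarrow> ('x \<Rightarrow> 'r) set" where
  "cochains T A =
     {f \<in> extensional (topspace T). continuous_map T (discrete_topology (carrier A)) f}"

definition coboundary1 ::
  "'g monoid \<Rightarrow> 'r ring \<Rightarrow> ('g \<Rightarrow> 'r) \<Rightarrow> 'g \<times> 'g \<Rightarrow> 'r" where
  "coboundary1 G A f =
     restrict (\<lambda>(\<sigma>, \<tau>). (f \<tau> \<ominus>\<^bsub>A\<^esub> f (\<sigma> \<otimes>\<^bsub>G\<^esub> \<tau>)) \<oplus>\<^bsub>A\<^esub> f \<sigma>) (carrier G \<times> carrier G)"

definition cocycles2 ::
  "'g monoid \<Rightarrow> 'g topology \<Rightarrow> 'r ring \<Rightarrow> ('g \<times> 'g \<Rightarrow> 'r) monoid" where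
  "cocycles2 G T A =
     \<lparr>carrier =
        {f \<in> cochains (prod_topology T T) A.
           \<forall>\<sigma>\<in>carrier G. \<forall>\<tau>\<in>carrier G. \<forall>\<rho>\<in>carrier G.
             ((f (\<tau>, \<rho>) \<ominus>\<^bsub>A\<^esub> f (\<sigma> \<otimes>\<^bsub>G\<^esub> \<tau>, \<rho>)) \<oplus>\<^bsub>A\<^esub> f (\<sigma>, \<tau> \<otimes>\<^bsub>G\<^esub> \<rho>)) \<ominus>\<^bsub>A\<^esub> f (\<sigma>, \<tau>)
               = \<zero>\<^bsub>A\<^esub>},
      monoid.mult = (\<lambda>f g. restrict (\<lambda>x. f x \<oplus>\<^bsub>A\<^esub> g x) (carrier G \<times> carrier G)),
      one = restrict (\<lambda>x. \<zero>\<^bsub>A\<^esub>) (carrier G \<times> carrier G)\<rparr>"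

definition coboundaries2 ::
  "'g monoid \<Rightarrow> 'g topology \<Rightarrow> 'r ring \<Rightarrow> ('g \<times> 'g \<Rightarrow> 'r) set" where
  "coboundaries2 G T A = coboundary1 G A ` cochains T A"

definition H2 ::
  "'g monoid \<Rightarrow> 'g topology \<Rightarrow> 'r ring \<Rightarrow> ('g \<times> 'g \<Rightarrow> 'r) set monoid" where
  "H2 G T A = cocycles2 G T A Mod coboundaries2 G T A"

text \<open>As the action is trivial, \<open>H\<^sup>1(G, A)\<close> consists of the continuous homomorphisms \<open>G \<rightarrow> A\<close>.\<close>

definition cup_product ::
  "'g monoid \<Rightarrow> 'g topology \<Rightarrow> 'r ring \<Rightarrow> ('g \<Rightarrow> 'r) \<Rightarrow> ('g \<Rightarrow> 'r) \<Rightarrow> ('g \<times> 'g \<Rightarrow> 'r) set" where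
  "cup_product G T A \<chi> \<psi> =
     coboundaries2 G T A #>\<^bsub>cocycles2 G T A\<^esub>
       restrict (\<lambda>(\<sigma>, \<tau>). \<chi> \<sigma> \<otimes>\<^bsub>A\<^esub> \<psi> \<tau>) (carrier G \<times> carrier G)"


section \<open>Kummer theory\<close>

text \<open>The defining relation does not depend on the choice of the root \<open>y\<close> when \<open>\<xi> \<in> F\<close>.\<close>

definition kummer_character ::
  "nat \<Rightarrow> 'a::field \<Rightarrow> 'a \<Rightarrow> ('a alg_closure \<Rightarrow> 'a alg_closure) \<Rightarrow> int" where
  "kummer_character p \<xi> x =
     (\<lambda>\<sigma> \<in> carrier abs_galois_group.
        THE k. k \<in> carrier (residue_ring (int p)) \<and>
               (\<forall>y. y ^ p = to_ac x \<longrightarrow> \<sigma> y = to_ac \<xi> ^ nat k * y))"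

text \<open>The condition \<open>\<chi>\<^sub>x \<union> \<chi>\<^sub>y = 0\<close> in \<open>H\<^sup>2(G\<^sub>F, \<int>/p\<int>)\<close>.\<close>

definition kummer_cup_vanishes :: "nat \<Rightarrow> 'a::field \<Rightarrow> 'a \<Rightarrow> 'a \<Rightarrow> bool" where
  "kummer_cup_vanishes p \<xi> x y \<longleftrightarrow>
     cup_product abs_galois_group abs_krull_topology (residue_ring (int p))
         (kummer_character p \<xi> x) (kummer_character p \<xi> y)
       = \<one>\<^bsub>H2 (abs_galois_group :: ('a alg_closure \<Rightarrow> 'a alg_closure) monoid)
            abs_krull_topology (residue_ring (int p))\<^esub>"

definition pth_powers :: "nat \<Rightarrow> 'a::field set" where
  "pth_powers p = {x ^ p | x. x \<noteq> 0}"

definition power_class_group :: "nat \<Rightarrow> 'a::field set monoid" where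
  "power_class_group p = mult_of ring_of_type_algebra Mod pth_powers p"

definition power_class :: "nat \<Rightarrow> 'a::field \<Rightarrow> 'a set" where
  "power_class p x = pth_powers p #>\<^bsub>mult_of ring_of_type_algebra\<^esub> x"

text \<open>
  Linear independence in the \<open>\<int>/p\<int>\<close>-vector space \<open>F\<^sup>\<times>/(F\<^sup>\<times>)\<^sup>p\<close>, written multiplicatively;
  the scalars are represented by \<open>0, \<dots>, p - 1\<close>.
\<close>

definition lin_indep_mod_powers :: "nat \<Rightarrow> 'a::field \<Rightarrow> 'a \<Rightarrow> bool" where
  "lin_indep_mod_powers p x y \<longleftrightarrow>
     (\<forall>i<p. \<forall>j<p.
        power_class p x [^]\<^bsub>power_class_group p\<^esub> i \<otimes>\<^bsub>power_class_group p\<^esub>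
          power_class p y [^]\<^bsub>power_class_group p\<^esub> j = \<one>\<^bsub>power_class_group p\<^esub>
        \<longrightarrow> i = 0 \<and> j = 0)"


section \<open>Coboundaries of a bicyclic group\<close>

definition cyclic_norm :: "nat \<Rightarrow> ('k::field \<Rightarrow> 'k) \<Rightarrow> 'k \<Rightarrow> 'k" where
  "cyclic_norm p \<sigma> x = (\<Prod>i=0..p-1. (\<sigma> ^^ i) x)"

text \<open>\<open>B\<^sup>2(G, E\<^sup>\<times>)\<close> for \<open>G\<close> the product of the cyclic groups of order \<open>p\<close> generated by \<open>\<sigma>\<close> and \<open>\<tau>\<close>.\<close>

definition bicyclic_B2 ::
  "nat \<Rightarrow> 'k::field set \<Rightarrow> ('k \<Rightarrow> 'k) \<Rightarrow> ('k \<Rightarrow> 'k) \<Rightarrow> ('k \<times> 'k \<times> 'k) set" where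
  "bicyclic_B2 p E \<sigma> \<tau> =
     {(x, y, z). x \<in> E - {0} \<and> y \<in> E - {0} \<and> z \<in> E - {0} \<and>
        (\<exists>C1 \<in> E - {0}. \<exists>C2 \<in> E - {0}.
           x = cyclic_norm p \<tau> C1 \<and>
           y = (\<sigma> C1 / C1) * (C2 / \<tau> C2) \<and>
           z = cyclic_norm p \<sigma> C2)}"

end

theory Submission
  imports Defs
begin

text \<open>
  Write \<open>\<sigma>, \<tau>\<close> for the generators \<open>\<sigma>\<^sub>a, \<sigma>\<^sub>c\<close> and \<open>N\<^sub>\<rho>\<close> for the norm of the cyclic group
  generated by \<open>\<rho>\<close>. The idea is to apply Hilbert's Theorem 90 to the \<^emph>\<open>diagonal\<close> cyclic group
  generated by \<open>\<sigma>\<tau>\<close>. Since \<open>\<tau>\<close> fixes \<open>\<alpha>\<close> and \<open>\<sigma>\<close> fixes \<open>\<gamma>\<close>, the norm of \<open>B = \<gamma>/\<alpha>\<close> along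
  \<open>\<sigma>\<tau>\<close> is \<open>N\<^sub>\<tau>(\<gamma>)/N\<^sub>\<sigma>(\<alpha>) = b/b = 1\<close>, so there is a \<open>C\<close> in \<open>E\<close> with
  \<open>B = \<sigma>(\<tau> C)/C = (\<sigma>(\<tau> C)/\<tau> C) \<cdot> (\<tau> C/C)\<close>.
  Hence \<open>C\<^sub>1 = \<tau> C\<close> and \<open>C\<^sub>2 = 1/C\<close> solve the middle equation of a coboundary
  (\<open>norm_quotient_is_boundary\<close>).

  The outer two equations then hold up to factors from \<open>F\<close>. The staircase product \<open>A\<^sub>0\<close> satisfies
  \<open>\<sigma>(A\<^sub>0)/A\<^sub>0 = N\<^sub>\<sigma>(\<alpha>)/\<alpha>\<^sup>p = N\<^sub>\<tau>(B)\<close>, and the middle equation gives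
  \<open>N\<^sub>\<tau>(B) = \<sigma>(N\<^sub>\<tau> C\<^sub>1)/N\<^sub>\<tau> C\<^sub>1\<close> as well. So \<open>N\<^sub>\<tau>(C\<^sub>1)/A\<^sub>0\<close> is fixed by \<open>\<sigma>\<close>, and it is
  clearly fixed by \<open>\<tau>\<close> (\<open>norm_over_staircase_invariant\<close>); being Galois invariant, it lies in \<open>F\<close>
  (\<open>bicyclic_kummer_fixed_field\<close>), and it serves as \<open>f\<^sub>a\<close>. Exchanging the roles of
  \<open>(\<sigma>, \<alpha>, C\<^sub>1)\<close> and \<open>(\<tau>, \<gamma>, C\<^sub>2)\<close> replaces \<open>B\<close> by its inverse and gives \<open>f\<^sub>c\<close>.

  Both Hilbert 90 and the computation of fixed fields become elementary because every cyclic group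
  that occurs has an eigenvector for the root of unity, namely a Kummer generator.
\<close>

section \<open>Roots of unity\<close>

definition primitive_root :: "nat \<Rightarrow> 'k::field \<Rightarrow> bool" where
  "primitive_root n \<zeta> \<longleftrightarrow> n > 0 \<and> \<zeta> ^ n = 1 \<and> (\<forall>k. 0 < k \<and> k < n \<longrightarrow> \<zeta> ^ k \<noteq> 1)"

lemma primitive_root_nonzero: "primitive_root n \<zeta> \<Longrightarrow> \<zeta> \<noteq> 0"
  by (auto simp: primitive_root_def power_0_left)

lemma primitive_root_power_eq_1_iff:
  assumes "primitive_root n \<zeta>"
  shows "\<zeta> ^ i = 1 \<longleftrightarrow> n dvd i"
proof -
  have "\<zeta> ^ i = \<zeta> ^ (n * (i div n) + i mod n)"
    by simp
  also have "\<dots> = \<zeta> ^ (i mod n)"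
    using assms by (simp only: power_add power_mult) (simp add: primitive_root_def)
  finally show ?thesis
    using assms unfolding primitive_root_def by (metis mod_less_divisor mod_greater_zero_iff_not_dvd dvd_imp_mod_0 power_0)
qed

lemma inj_on_primitive_root_powers:
  assumes "primitive_root n \<zeta>"
  shows "inj_on (\<lambda>k. \<zeta> ^ k) {..<n}"
proof (rule linorder_inj_onI)
  fix i j assume "i < j" "i \<in> {..<n}" "j \<in> {..<n}"
  moreover have "\<zeta> ^ j = \<zeta> ^ i * \<zeta> ^ (j - i)"
    using \<open>i < j\<close> by (simp flip: power_add)
  ultimately show "\<zeta> ^ i \<noteq> \<zeta> ^ j"
    using assms primitive_root_nonzero[OF assms] by (auto simp: primitive_root_def)
qed auto

text \<open>
  The \<open>n\<close> distinct powers of \<open>\<zeta>\<close> already exhaust the at most \<open>n\<close> roots of \<open>X\<^sup>n - 1\<close>.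
\<close>

lemma primitive_root_powers_exhaust:
  assumes "primitive_root n \<zeta>" "y ^ n = 1"
  obtains k where "k < n" "y = \<zeta> ^ k"
proof -
  have n: "n > 0" using assms by (simp add: primitive_root_def)
  let ?P = "monom 1 n - 1 :: 'a poly"
  have deg: "degree ?P = n"
    using n by (subst diff_conv_add_uminus, subst degree_add_eq_left) (simp_all add: degree_monom_eq)
  then have "?P \<noteq> 0" using n by (metis degree_0 less_irrefl)
  then have "finite {x. poly ?P x = 0}" "card {x. poly ?P x = 0} \<le> n"
    using card_poly_roots_bound[of ?P] deg poly_roots_finite[of ?P] by simp_all
  moreover have "{x. poly ?P x = 0} = {x. x ^ n = 1}"
    by (simp add: poly_monom)
  moreover have "(\<lambda>k. \<zeta> ^ k) ` {..<n} \<subseteq> {x. x ^ n = 1}"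
    using assms(1) by (auto simp: primitive_root_def) (metis mult.commute power_mult power_one)
  moreover have "card ((\<lambda>k. \<zeta> ^ k) ` {..<n}) = n"
    using inj_on_primitive_root_powers[OF assms(1)] by (simp add: card_image)
  ultimately have "(\<lambda>k. \<zeta> ^ k) ` {..<n} = {x. x ^ n = 1}"
    by (metis card_seteq)
  with assms(2) that show ?thesis by auto
qed

lemma sum_primitive_root_powers:
  assumes "primitive_root n \<zeta>"
  shows "(\<Sum>j<n. \<zeta> ^ (i * j)) = (if n dvd i then of_nat n else 0)"
proof (cases "n dvd i")
  case True
  then have "\<zeta> ^ i = 1" using primitive_root_power_eq_1_iff[OF assms] by blast
  then show ?thesis using True by (simp add: power_mult)
next
  case False
  then have "\<zeta> ^ i \<noteq> 1" using primitive_root_power_eq_1_iff[OF assms] by blast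
  moreover have "(\<zeta> ^ i) ^ n = 1"
    using assms by (metis primitive_root_def mult.commute power_mult power_one)
  ultimately show ?thesis using False by (simp add: power_mult geometric_sum)
qed

text \<open>
  In characteristic \<open>p\<close> one has \<open>X\<^sup>p - 1 = (X - 1)\<^sup>p\<close>, so \<open>1\<close> would be the only \<open>p\<close>-th root of unity.
\<close>

lemma primitive_prime_root_of_nat_nonzero:
  fixes \<zeta> :: "'k::field"
  assumes "primitive_root p \<zeta>" "prime p"
  shows "of_nat p \<noteq> (0 :: 'k)"
proof
  assume "of_nat p = (0 :: 'k)"
  then have "CHAR('k) dvd p" by (simp add: of_nat_eq_0_iff_char_dvd)
  with \<open>prime p\<close> have p: "CHAR('k) = p"
    by (metis CHAR_not_1' One_nat_def prime_nat_iff)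
  have "(\<zeta> - 1 + 1) ^ p = (\<zeta> - 1) ^ p + 1 ^ p"
    using assms(2) by (intro freshmans_dream) (simp_all add: p)
  then have "\<zeta> = 1" using assms(1) by (simp add: primitive_root_def)
  then show False
    using assms prime_gt_1_nat[of p] by (auto simp: primitive_root_def)
qed


section \<open>Subfields and their embeddings\<close>

text \<open>
  A subfield in terms of the type class operations. It is used in place of \<^const>\<open>subfield\<close> so that
  the closure rules apply without translating between record operations and class operations.
\<close>

locale type_subfield =
  fixes K :: "'k::field set"
  assumes one [simp]: "1 \<in> K"
    and add [simp]: "\<And>x y. x \<in> K \<Longrightarrow> y \<in> K \<Longrightarrow> x + y \<in> K"
    and uminus [simp]: "\<And>x. x \<in> K \<Longrightarrow> - x \<in> K"
    and mult [simp]: "\<And>x y. x \<in> K \<Longrightarrow> y \<in> K \<Longrightarrow> x * y \<in> K"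
    and inverse [simp]: "\<And>x. x \<in> K \<Longrightarrow> inverse x \<in> K"
begin

lemma zero [simp]: "0 \<in> K"
  using add[OF one uminus[OF one]] by simp

lemma divide [simp]: "x \<in> K \<Longrightarrow> y \<in> K \<Longrightarrow> x / y \<in> K"
  by (simp add: divide_inverse)

lemma power [simp]: "x \<in> K \<Longrightarrow> x ^ n \<in> K"
  by (induction n) auto

lemma sum: "(\<And>i. i \<in> I \<Longrightarrow> f i \<in> K) \<Longrightarrow> sum f I \<in> K"
  by (induction I rule: infinite_finite_induct) auto

lemma prod: "(\<And>i. i \<in> I \<Longrightarrow> f i \<in> K) \<Longrightarrow> prod f I \<in> K"
  by (induction I rule: infinite_finite_induct) auto

lemma of_nat [simp]: "of_nat n \<in> K"
  by (induction n) auto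

end

text \<open>
  Only the values on \<open>K\<close> are constrained, and they may lie outside \<open>K\<close>. This covers the embeddings
  that enter \<^const>\<open>field_norm\<close> as well as restrictions of automorphisms to smaller fields.
\<close>

locale subfield_hom = type_subfield K for K :: "'k::field set" +
  fixes \<sigma> :: "'k \<Rightarrow> 'k"
  assumes hom_one [simp]: "\<sigma> 1 = 1"
    and hom_add [simp]: "\<And>x y. x \<in> K \<Longrightarrow> y \<in> K \<Longrightarrow> \<sigma> (x + y) = \<sigma> x + \<sigma> y"
    and hom_mult [simp]: "\<And>x y. x \<in> K \<Longrightarrow> y \<in> K \<Longrightarrow> \<sigma> (x * y) = \<sigma> x * \<sigma> y"
begin

lemma hom_zero [simp]: "\<sigma> 0 = 0"
  using hom_add[OF zero zero] by (metis add_cancel_right_right)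

lemma hom_uminus [simp]: "x \<in> K \<Longrightarrow> \<sigma> (- x) = - \<sigma> x"
  using hom_add[of x "- x"] by (simp del: hom_add add: eq_neg_iff_add_eq_0 add.commute)

lemma hom_eq_0_iff [simp]: "x \<in> K \<Longrightarrow> \<sigma> x = 0 \<longleftrightarrow> x = 0"
  using hom_mult[of x "inverse x"] by (cases "x = 0") (auto simp del: hom_mult)

lemma hom_inverse [simp]: "x \<in> K \<Longrightarrow> \<sigma> (inverse x) = inverse (\<sigma> x)"
  using hom_mult[of x "inverse x"]
  by (cases "x = 0") (auto simp del: hom_mult intro: inverse_unique[symmetric])

lemma hom_divide [simp]: "x \<in> K \<Longrightarrow> y \<in> K \<Longrightarrow> \<sigma> (x / y) = \<sigma> x / \<sigma> y"
  by (simp add: divide_inverse)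

lemma hom_power [simp]: "x \<in> K \<Longrightarrow> \<sigma> (x ^ n) = \<sigma> x ^ n"
  by (induction n) auto

lemma hom_sum: "(\<And>i. i \<in> I \<Longrightarrow> f i \<in> K) \<Longrightarrow> \<sigma> (sum f I) = (\<Sum>i\<in>I. \<sigma> (f i))"
  by (induction I rule: infinite_finite_induct) (simp_all add: sum)

lemma hom_prod: "(\<And>i. i \<in> I \<Longrightarrow> f i \<in> K) \<Longrightarrow> \<sigma> (prod f I) = (\<Prod>i\<in>I. \<sigma> (f i))"
  by (induction I rule: infinite_finite_induct) (simp_all add: prod)

lemma restrict_to_subfield: "type_subfield L \<Longrightarrow> L \<subseteq> K \<Longrightarrow> subfield_hom L \<sigma>"
  by (intro subfield_hom.intro subfield_hom_axioms.intro) (auto simp: subset_iff)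

end

lemma equalizer_subfield:
  assumes "subfield_hom K \<sigma>" "subfield_hom K \<tau>"
  shows "type_subfield {x \<in> K. \<sigma> x = \<tau> x}"
proof -
  interpret s: subfield_hom K \<sigma> by fact
  interpret t: subfield_hom K \<tau> by fact
  show ?thesis by unfold_locales auto
qed

lemma inverse_ring_of_type_algebra:
  fixes x :: "'k::field"
  assumes "x \<noteq> 0"
  shows "inv\<^bsub>ring_of_type_algebra\<^esub> x = inverse x"
proof -
  interpret field "ring_of_type_algebra :: 'k ring" by (rule field_from_type_algebra)
  show ?thesis
    by (rule comm_inv_char) (use assms in \<open>auto simp: ring_of_type_algebra_def\<close>)
qed

lemma uminus_ring_of_type_algebra:
  fixes x :: "'k::field"
  shows "\<ominus>\<^bsub>ring_of_type_algebra\<^esub> x = - x"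
proof -
  interpret field "ring_of_type_algebra :: 'k ring" by (rule field_from_type_algebra)
  show ?thesis
    by (rule minus_equality) (auto simp: ring_of_type_algebra_def)
qed

lemma simps_ring_of_type_algebra:
  "carrier ring_of_type_algebra = UNIV"
  "\<one>\<^bsub>ring_of_type_algebra\<^esub> = 1"
  "\<zero>\<^bsub>ring_of_type_algebra\<^esub> = 0"
  "x \<oplus>\<^bsub>ring_of_type_algebra\<^esub> y = x + y"
  "x \<otimes>\<^bsub>ring_of_type_algebra\<^esub> y = x * y"
  by (simp_all add: ring_of_type_algebra_def)

lemma adjoin_superset: "F \<union> S \<subseteq> adjoin F S"
  by (auto simp: adjoin_def intro: generate_field.incl)

lemma type_subfield_adjoin: "type_subfield (adjoin F S)"
proof
  fix x y assume x: "x \<in> adjoin F S"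
  show "inverse x \<in> adjoin F S"
    using x generate_field.m_inv[of x ring_of_type_algebra "F \<union> S"]
    by (cases "x = 0")
       (auto simp: adjoin_def inverse_ring_of_type_algebra simps_ring_of_type_algebra)
  show "- x \<in> adjoin F S"
    using x generate_field.a_inv[of x ring_of_type_algebra "F \<union> S"]
    by (simp add: adjoin_def uminus_ring_of_type_algebra)
  assume y: "y \<in> adjoin F S"
  show "x + y \<in> adjoin F S" "x * y \<in> adjoin F S"
    using x y generate_field.eng_add[of x ring_of_type_algebra "F \<union> S" y]
      generate_field.eng_mult[of x ring_of_type_algebra "F \<union> S" y]
    by (simp_all add: adjoin_def simps_ring_of_type_algebra)
qed (use generate_field.one[of ring_of_type_algebra "F \<union> S"]
     in \<open>simp add: adjoin_def simps_ring_of_type_algebra\<close>)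

lemma adjoin_least:
  assumes "type_subfield K" "F \<union> S \<subseteq> K"
  shows "adjoin F S \<subseteq> K"
proof
  interpret type_subfield K by fact
  fix x assume "x \<in> adjoin F S"
  then show "x \<in> K" unfolding adjoin_def
    by (induction rule: generate_field.induct)
       (use assms(2) in \<open>auto simp: simps_ring_of_type_algebra uminus_ring_of_type_algebra
          inverse_ring_of_type_algebra\<close>)
qed

text \<open>
  The elements where two homomorphisms agree form a subfield. This reduces every identity between
  automorphisms below (commutation, order, fixed elements) to a check on generators.
\<close>

lemma subfield_homs_agree_on_adjoin:
  assumes "subfield_hom K \<sigma>" "subfield_hom K \<tau>" "F \<union> S \<subseteq> K"
    and "\<And>x. x \<in> F \<union> S \<Longrightarrow> \<sigma> x = \<tau> x" and "x \<in> adjoin F S"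
  shows "\<sigma> x = \<tau> x"
  using adjoin_least[OF equalizer_subfield[OF assms(1,2)], of F S] assms(3-5) by blast

lemma embeddingsD:
  assumes "\<sigma> \<in> embeddings F K" "type_subfield K"
  shows "subfield_hom K \<sigma>" and "\<And>x. x \<in> F \<Longrightarrow> \<sigma> x = x" and "\<sigma> \<in> extensional K"
  using assms
  by (auto simp: embeddings_def ring_hom_def simps_ring_of_type_algebra
      intro!: subfield_hom.intro subfield_hom_axioms.intro)

lemma embeddingsI:
  assumes "subfield_hom K \<sigma>" "\<And>x. x \<in> F \<Longrightarrow> \<sigma> x = x" "F \<subseteq> K"
  shows "restrict \<sigma> K \<in> embeddings F K"
proof -
  interpret subfield_hom K \<sigma> by fact
  show ?thesis using assms(2,3)
    by (auto simp: embeddings_def ring_hom_def simps_ring_of_type_algebra)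
qed


section \<open>Kummer extensions\<close>

lemma type_subfield_base_field: "type_subfield (base_field :: 'a::field alg_closure set)"
proof
  show "1 \<in> (base_field :: 'a alg_closure set)"
    using to_ac_1 by (metis rangeI)
qed (auto simp flip: to_ac_add to_ac_minus to_ac_mult to_ac_inverse)

text \<open>
  In an algebraic extension the inverse of \<open>x\<close> is a polynomial in \<open>x\<close>: cancel powers of \<open>x\<close> from an
  equation until its constant term \<open>a\<close> is nonzero; then \<open>a + x q(x) = 0\<close> gives
  \<open>x\<inverse> = - a\<inverse> q(x)\<close>.
\<close>

lemma intermediate_ring_is_subfield:
  fixes R :: "'a::field alg_closure set"
  assumes base: "base_field \<subseteq> R"
    and add: "\<And>x y. x \<in> R \<Longrightarrow> y \<in> R \<Longrightarrow> x + y \<in> R"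
    and mult: "\<And>x y. x \<in> R \<Longrightarrow> y \<in> R \<Longrightarrow> x * y \<in> R"
  shows "type_subfield R"
proof
  interpret F: type_subfield "base_field :: 'a alg_closure set"
    by (rule type_subfield_base_field)
  show "1 \<in> R" using base F.one by blast
  show "- x \<in> R" if "x \<in> R" for x
    using mult[of "-1" x] that subsetD[OF base F.uminus[OF F.one]] by simp
  have poly_closed: "poly (map_poly to_ac q) x \<in> R" if "x \<in> R" for q :: "'a poly" and x
    by (induction q) (use base F.zero that in \<open>auto simp: map_poly_pCons intro!: add mult\<close>)
  show "inverse x \<in> R" if x: "x \<in> R" for x
  proof (cases "x = 0")
    case False
    obtain q :: "'a poly" where "q \<noteq> 0" "poly (map_poly to_ac q) x = 0"
      by (rule alg_closure_algebraic)
    then show ?thesis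
    proof (induction q)
      case (pCons a q)
      show ?case
      proof (cases "a = 0")
        case True
        with pCons False show ?thesis by (auto simp: map_poly_pCons)
      next
        case a: False
        have "to_ac a + x * poly (map_poly to_ac q) x = 0"
          using pCons.prems by (simp add: map_poly_pCons)
        then have "x * poly (map_poly to_ac q) x = - to_ac a"
          by (simp add: eq_neg_iff_add_eq_0 add.commute)
        then have "x * (to_ac (- inverse a) * poly (map_poly to_ac q) x) = 1"
          using a by (simp add: field_simps)
        then have "inverse x = to_ac (- inverse a) * poly (map_poly to_ac q) x"
          by (rule inverse_unique)
        also have "\<dots> \<in> R" using base poly_closed[OF x] by (intro mult) auto
        finally show ?thesis .
      qed
    qed simp
  qed (use base F.zero in auto)
qed (use add mult in auto)

lemma simple_extension_polynomial:
  fixes K :: "'a::field alg_closure set"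
  assumes "type_subfield K" "base_field \<subseteq> K" "x \<in> adjoin K {r}"
  obtains q where "\<And>i. coeff q i \<in> K" "x = poly q r"
proof -
  interpret type_subfield K by fact
  let ?R = "{poly q r | q. \<forall>i. coeff q i \<in> K}"
  have const: "y \<in> ?R" if "y \<in> K" for y
    using that by (auto intro!: exI[of _ "[:y:]"] simp: coeff_pCons split: nat.split)
  have gen: "r \<in> ?R"
    by (auto intro!: exI[of _ "[:0, 1:]"] simp: coeff_pCons split: nat.split)
  have "type_subfield ?R"
  proof (rule intermediate_ring_is_subfield)
    show "base_field \<subseteq> ?R" using const assms(2) by blast
  next
    fix x y assume "x \<in> ?R" "y \<in> ?R"
    then obtain q q' where q: "x = poly q r" "\<forall>i. coeff q i \<in> K"
      and q': "y = poly q' r" "\<forall>i. coeff q' i \<in> K" by blast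
    show "x + y \<in> ?R" using q q' by (auto intro!: exI[of _ "q + q'"])
    show "x * y \<in> ?R" using q q' by (auto intro!: exI[of _ "q * q'"] sum simp: coeff_mult)
  qed
  then have "adjoin K {r} \<subseteq> ?R"
    by (rule adjoin_least) (use const gen in auto)
  with assms(3) that show ?thesis by blast
qed

text \<open>
  Write \<open>x = q(r)\<close> with a polynomial \<open>q\<close> over \<open>K\<close>. Iterating \<open>\<sigma>\<close> gives \<open>x = q(\<zeta>\<^sup>j r)\<close> for all
  \<open>j\<close>, and averaging over \<open>j < p\<close> removes all monomials of \<open>q\<close> except those with exponent
  divisible by \<open>p\<close>. The remaining ones are polynomials in \<open>r\<^sup>p \<in> K\<close>. The average makes sense as
  \<open>p\<close> is invertible.
\<close>

lemma kummer_fixed_field: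
  fixes K :: "'a::field alg_closure set"
  assumes K: "type_subfield K" "base_field \<subseteq> K"
    and hom: "subfield_hom L \<sigma>" "adjoin K {r} \<subseteq> L"
    and fixes_K: "\<And>x. x \<in> K \<Longrightarrow> \<sigma> x = x"
    and \<zeta>: "primitive_root p \<zeta>" "prime p" "\<zeta> \<in> K"
    and r: "\<sigma> r = \<zeta> * r" "r ^ p \<in> K"
    and x: "x \<in> adjoin K {r}" "\<sigma> x = x"
  shows "x \<in> K"
proof -
  interpret K: type_subfield K by fact
  interpret L: subfield_hom L \<sigma> by fact
  have KL: "K \<subseteq> L" and rL: "r \<in> L" using adjoin_superset[of K "{r}"] hom(2) by auto
  obtain q where q: "\<And>i. coeff q i \<in> K" "x = poly q r"
    using simple_extension_polynomial[OF K x(1)] by blast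
  have hom_poly: "\<sigma> (poly q y) = poly q (\<sigma> y)" if "y \<in> L" for y
    using q(1) KL that fixes_K
    by (auto simp: poly_altdef L.hom_sum subset_iff intro!: sum.cong)
  have conj: "x = poly q (\<zeta> ^ j * r)" for j
  proof (induction j)
    case (Suc j)
    have "\<sigma> (poly q (\<zeta> ^ j * r)) = poly q (\<zeta> ^ Suc j * r)"
      using KL rL \<zeta>(3) fixes_K r(1) by (subst hom_poly) (auto simp: subset_iff mult_ac)
    then show ?case using Suc x(2) by simp
  qed (use q in simp)
  have "of_nat p * x = (\<Sum>j<p. poly q (\<zeta> ^ j * r))"
    using conj by simp
  also have "\<dots> = (\<Sum>j<p. \<Sum>i\<le>degree q. coeff q i * r ^ i * \<zeta> ^ (i * j))"
    by (simp add: poly_altdef power_mult_distrib power_mult[symmetric] mult_ac)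
  also have "\<dots> = (\<Sum>i\<le>degree q. coeff q i * r ^ i * (\<Sum>j<p. \<zeta> ^ (i * j)))"
    by (subst sum.swap) (simp add: sum_distrib_left)
  also have "\<dots> \<in> K"
  proof (rule K.sum)
    fix i
    have "r ^ i \<in> K" if "p dvd i"
      using that r(2) by (auto simp: power_mult)
    then show "coeff q i * r ^ i * (\<Sum>j<p. \<zeta> ^ (i * j)) \<in> K"
      using q(1) by (auto simp: sum_primitive_root_powers[OF \<zeta>(1)])
  qed
  finally have "of_nat p * x / of_nat p \<in> K" by (rule K.divide) simp
  moreover have "of_nat p * x / of_nat p = x"
    using primitive_prime_root_of_nat_nonzero[OF \<zeta>(1,2)] by simp
  ultimately show ?thesis by simp
qed


section \<open>Norms of cyclic group actions\<close>

locale subfield_endo = subfield_hom K \<sigma> for K :: "'k::field set" and \<sigma> +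
  assumes closed [simp]: "x \<in> K \<Longrightarrow> \<sigma> x \<in> K"
begin

lemma funpow_closed [simp]: "x \<in> K \<Longrightarrow> (\<sigma> ^^ n) x \<in> K"
  by (induction n) auto

lemma subfield_endo_funpow: "subfield_endo K (\<sigma> ^^ n)"
proof
  show "(\<sigma> ^^ n) 1 = 1" by (induction n) auto
next
  fix x y assume "x \<in> K" "y \<in> K"
  then show "(\<sigma> ^^ n) (x + y) = (\<sigma> ^^ n) x + (\<sigma> ^^ n) y"
    "(\<sigma> ^^ n) (x * y) = (\<sigma> ^^ n) x * (\<sigma> ^^ n) y"
    by (induction n) auto
qed auto

end

lemma subfield_endo_comp:
  assumes "subfield_endo K \<sigma>" "subfield_endo K \<tau>"
  shows "subfield_endo K (\<sigma> \<circ> \<tau>)"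
proof -
  interpret s: subfield_endo K \<sigma> by fact
  interpret t: subfield_endo K \<tau> by fact
  show ?thesis by unfold_locales auto
qed

lemma funpow_fixed: "f x = x \<Longrightarrow> (f ^^ n) x = x"
  by (induction n) auto

lemma cyclic_norm_lessThan: "n > 0 \<Longrightarrow> cyclic_norm n \<sigma> x = (\<Prod>i<n. (\<sigma> ^^ i) x)"
  unfolding cyclic_norm_def by (rule prod.cong) auto

lemma cyclic_norm_fixed:
  assumes "n > 0" "\<sigma> x = x"
  shows "cyclic_norm n \<sigma> x = x ^ n"
  using assms by (simp add: cyclic_norm_lessThan funpow_fixed)

text \<open>
  The relation \<open>\<sigma>\<^sup>n = 1\<close> is imposed on \<open>K\<close> alone, because elements of a Galois group are undefined
  elsewhere.
\<close>

locale cyclic_action = subfield_endo K \<sigma> for K :: "'k::field set" and \<sigma> +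
  fixes n :: nat
  assumes pos: "n > 0"
    and order: "x \<in> K \<Longrightarrow> (\<sigma> ^^ n) x = x"
begin

lemma norm_closed [simp]: "x \<in> K \<Longrightarrow> cyclic_norm n \<sigma> x \<in> K"
  by (simp add: cyclic_norm_def prod)

lemma norm_mult:
  assumes "x \<in> K" "y \<in> K"
  shows "cyclic_norm n \<sigma> (x * y) = cyclic_norm n \<sigma> x * cyclic_norm n \<sigma> y"
  using assms subfield_hom.hom_mult[OF subfield_endo.axioms(1)[OF subfield_endo_funpow]]
  by (simp add: cyclic_norm_def prod.distrib)

lemma norm_divide:
  assumes "x \<in> K" "y \<in> K"
  shows "cyclic_norm n \<sigma> (x / y) = cyclic_norm n \<sigma> x / cyclic_norm n \<sigma> y"
  using assms subfield_hom.hom_divide[OF subfield_endo.axioms(1)[OF subfield_endo_funpow]]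
  by (simp add: cyclic_norm_def prod_dividef)

lemma norm_eq_0_iff [simp]: "x \<in> K \<Longrightarrow> cyclic_norm n \<sigma> x = 0 \<longleftrightarrow> x = 0"
  using subfield_hom.hom_eq_0_iff[OF subfield_endo.axioms(1)[OF subfield_endo_funpow]] pos
  by (auto simp: cyclic_norm_def)

lemma prod_rotate:
  assumes "x \<in> K"
  shows "(\<Prod>i<n. (\<sigma> ^^ Suc i) x) = (\<Prod>i<n. (\<sigma> ^^ i) x)"
proof -
  obtain m where n: "n = Suc m" using pos gr0_implies_Suc by blast
  show ?thesis
    using order[OF assms] unfolding n prod.lessThan_Suc_shift[of "\<lambda>i. (\<sigma> ^^ i) x"]
    by (simp add: mult.commute)
qed

lemma norm_invariant [simp]: "x \<in> K \<Longrightarrow> \<sigma> (cyclic_norm n \<sigma> x) = cyclic_norm n \<sigma> x"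
  using prod_rotate[of x] by (simp add: cyclic_norm_lessThan pos hom_prod)

lemma norm_conjugate [simp]: "x \<in> K \<Longrightarrow> cyclic_norm n \<sigma> (\<sigma> x) = cyclic_norm n \<sigma> x"
  using prod_rotate[of x] by (simp add: cyclic_norm_lessThan pos funpow_swap1)

lemma norm_commute:
  assumes "subfield_hom K \<tau>" "\<And>y. y \<in> K \<Longrightarrow> \<tau> (\<sigma> y) = \<sigma> (\<tau> y)" "x \<in> K"
  shows "\<tau> (cyclic_norm n \<sigma> x) = cyclic_norm n \<sigma> (\<tau> x)"
proof -
  have "\<tau> ((\<sigma> ^^ i) x) = (\<sigma> ^^ i) (\<tau> x)" for i
    using assms(2,3) by (induction i) auto
  then show ?thesis
    using assms(3) by (simp add: cyclic_norm_def subfield_hom.hom_prod[OF assms(1)])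
qed

text \<open>
  Multiplying \<open>A\<close> by the norm raises each exponent \<open>n - i - 1\<close> to \<open>n - i\<close>. Splitting off the factor
  with \<open>i = 0\<close> leaves the exponents of \<open>\<sigma>(A)\<close>.
\<close>

lemma staircase_product:
  assumes "x \<in> K"
  defines "A \<equiv> \<Prod>i<n. (\<sigma> ^^ i) x ^ (n - i - 1)"
  shows "\<sigma> A * x ^ n = A * cyclic_norm n \<sigma> x"
proof -
  obtain m where n: "n = Suc m" using pos gr0_implies_Suc by blast
  have "A * cyclic_norm n \<sigma> x = (\<Prod>i<n. (\<sigma> ^^ i) x ^ (n - i))"
    unfolding A_def cyclic_norm_lessThan[OF pos] prod.distrib[symmetric]
    by (rule prod.cong) (auto simp flip: power_Suc2 simp: Suc_diff_Suc)
  also have "\<dots> = x ^ n * (\<Prod>i<m. (\<sigma> ^^ Suc i) x ^ (n - Suc i))"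
    unfolding n by (subst prod.lessThan_Suc_shift) simp
  also have "(\<Prod>i<m. (\<sigma> ^^ Suc i) x ^ (n - Suc i)) = (\<Prod>i<n. (\<sigma> ^^ Suc i) x ^ (n - Suc i))"
    unfolding n by simp
  also have "\<dots> = \<sigma> A"
    using assms(1) by (simp add: A_def hom_prod)
  finally show ?thesis by (simp add: mult.commute)
qed

text \<open>
  The classical resolvent \<open>D = \<Sum>\<^sub>i x \<sigma>(x) \<dots> \<sigma>\<^sup>i\<^sup>-\<^sup>1(x) \<sigma>\<^sup>i(y)\<close> satisfies \<open>x \<sigma>(D) = D\<close> when \<open>x\<close> has norm
  \<open>1\<close>; it remains to choose \<open>y\<close> with \<open>D \<noteq> 0\<close>. The powers of the eigenvector \<open>\<theta>\<close> are natural
  candidates: for \<open>y = \<theta>\<^sup>k\<close> the resolvent is \<open>\<theta>\<^sup>k P(\<zeta>\<^sup>k)\<close>, where \<open>P\<close> is a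
  nonzero polynomial of degree less than \<open>n\<close>, and \<open>P\<close> cannot vanish at all \<open>n\<close> powers of \<open>\<zeta>\<close>.
\<close>

theorem hilbert_90:
  assumes eigen: "\<theta> \<in> K" "\<theta> \<noteq> 0" "\<sigma> \<theta> = \<zeta> * \<theta>"
    and \<zeta>: "primitive_root n \<zeta>" "\<zeta> \<in> K" "\<sigma> \<zeta> = \<zeta>"
    and x: "x \<in> K" "cyclic_norm n \<sigma> x = 1"
  obtains C where "C \<in> K" "C \<noteq> 0" "x = \<sigma> C / C"
proof -
  define b where "b i = (\<Prod>j<i. (\<sigma> ^^ j) x)" for i
  have b_closed: "b i \<in> K" for i
    using x(1) by (simp add: b_def prod)
  have b_Suc: "x * \<sigma> (b i) = b (Suc i)" for i
    using x(1) by (simp add: b_def hom_prod prod.lessThan_Suc_shift del: prod.lessThan_Suc)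
  have b_n: "b n = 1" using x(2) pos by (simp add: b_def cyclic_norm_lessThan)
  define P where "P = (\<Sum>i<n. monom (b i) i)"
  have "coeff P 0 = 1"
    using pos by (simp add: P_def coeff_sum b_def)
  then have "P \<noteq> 0" by auto
  have "degree P < n"
    using pos degree_sum_less[of "{..<n}" "\<lambda>i. monom (b i) i" n] 
    unfolding P_def by (simp add: le_less_trans[OF degree_monom_le])
  obtain k where k: "poly P (\<zeta> ^ k) \<noteq> 0"
  proof -
    have "\<not> (\<lambda>k. \<zeta> ^ k) ` {..<n} \<subseteq> {y. poly P y = 0}"
    proof
      assume "(\<lambda>k. \<zeta> ^ k) ` {..<n} \<subseteq> {y. poly P y = 0}"
      then have "card ((\<lambda>k. \<zeta> ^ k) ` {..<n}) \<le> card {y. poly P y = 0}"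
        by (rule card_mono[OF poly_roots_finite[OF \<open>P \<noteq> 0\<close>]])
      moreover have "card ((\<lambda>k. \<zeta> ^ k) ` {..<n}) = n"
        using inj_on_primitive_root_powers[OF \<zeta>(1)] by (simp add: card_image)
      ultimately have "n \<le> card {y. poly P y = 0}" by simp
      also have "\<dots> \<le> degree P" by (rule card_poly_roots_bound) fact
      finally show False using \<open>degree P < n\<close> by simp
    qed
    with that show ?thesis by blast
  qed
  have eigen_power: "(\<sigma> ^^ i) (\<theta> ^ k) = \<zeta> ^ (i * k) * \<theta> ^ k" for i
    by (induction i) (use eigen \<zeta> in \<open>auto simp: power_mult_distrib power_add\<close>)
  define D where "D = (\<Sum>i<n. b i * (\<sigma> ^^ i) (\<theta> ^ k))"
  have D: "D \<in> K" unfolding D_def using b_closed eigen(1) by (intro sum) simp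
  have "D = \<theta> ^ k * poly P (\<zeta> ^ k)"
    unfolding D_def P_def eigen_power
    by (simp add: poly_sum poly_monom sum_distrib_left power_mult[symmetric] mult_ac)
  then have "D \<noteq> 0" using k eigen(2) by simp
  \<comment> \<open>Applying \<open>\<sigma>\<close> and multiplying by \<open>x\<close> rotates the summands of \<open>D\<close>, since \<open>b n = b 0 = 1\<close>.\<close>
  have "x * \<sigma> D = (\<Sum>i<n. b (Suc i) * (\<sigma> ^^ Suc i) (\<theta> ^ k))"
    unfolding D_def using b_closed eigen(1)
    by (simp add: hom_sum sum_distrib_left b_Suc[symmetric] mult_ac)
  also have "\<dots> + b 0 * (\<sigma> ^^ 0) (\<theta> ^ k) = D + b n * (\<sigma> ^^ n) (\<theta> ^ k)"
    using sum.lessThan_Suc_shift[of "\<lambda>i. b i * (\<sigma> ^^ i) (\<theta> ^ k)" n,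
        unfolded sum.lessThan_Suc]
    unfolding D_def by (simp only: add.commute)
  also have "b n * (\<sigma> ^^ n) (\<theta> ^ k) = b 0 * (\<sigma> ^^ 0) (\<theta> ^ k)"
    using order[of "\<theta> ^ k"] eigen(1) b_n by (simp add: b_def)
  finally have "x * \<sigma> D = D" by simp
  then have "x = \<sigma> (inverse D) / inverse D"
    using D \<open>D \<noteq> 0\<close> by (simp add: field_simps)
  with that[of "inverse D"] D \<open>D \<noteq> 0\<close> show ?thesis by simp
qed

end


section \<open>Coboundaries of bicyclic groups\<close>

locale bicyclic_action =
  s: cyclic_action K \<sigma> n + t: cyclic_action K \<tau> n for K :: "'k::field set" and \<sigma> \<tau> n +
  assumes commute: "x \<in> K \<Longrightarrow> \<sigma> (\<tau> x) = \<tau> (\<sigma> x)"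
begin

lemma commute_funpow: "x \<in> K \<Longrightarrow> (\<sigma> ^^ i) (\<tau> x) = \<tau> ((\<sigma> ^^ i) x)"
  by (induction i) (auto simp: commute)

lemma commute_funpow': "x \<in> K \<Longrightarrow> \<sigma> ((\<tau> ^^ i) x) = (\<tau> ^^ i) (\<sigma> x)"
  by (induction i) (auto simp: commute)

lemma comp_funpow: "x \<in> K \<Longrightarrow> ((\<sigma> \<circ> \<tau>) ^^ i) x = (\<sigma> ^^ i) ((\<tau> ^^ i) x)"
  by (induction i) (auto simp: commute_funpow)

lemma cyclic_action_comp: "cyclic_action K (\<sigma> \<circ> \<tau>) n"
proof (intro cyclic_action.intro cyclic_action_axioms.intro)
  show "subfield_endo K (\<sigma> \<circ> \<tau>)"
    by (intro subfield_endo_comp s.subfield_endo_axioms t.subfield_endo_axioms)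
qed (use s.pos s.order t.order comp_funpow in auto)

text \<open>
  The eigenvector \<open>\<theta>\<close> makes Hilbert 90 available for \<open>\<sigma>\<tau>\<close>, along which \<open>\<gamma>/\<alpha>\<close> has norm \<open>1\<close>.
\<close>

lemma norm_quotient_is_boundary:
  assumes eigen: "\<theta> \<in> K" "\<theta> \<noteq> 0" "\<sigma> (\<tau> \<theta>) = \<zeta> * \<theta>"
    and \<zeta>: "primitive_root n \<zeta>" "\<zeta> \<in> K" "\<sigma> \<zeta> = \<zeta>" "\<tau> \<zeta> = \<zeta>"
    and \<alpha>: "\<alpha> \<in> K" "\<alpha> \<noteq> 0" "\<tau> \<alpha> = \<alpha>"
    and \<gamma>: "\<gamma> \<in> K" "\<gamma> \<noteq> 0" "\<sigma> \<gamma> = \<gamma>"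
    and norm: "cyclic_norm n \<tau> \<gamma> = cyclic_norm n \<sigma> \<alpha>"
  obtains C1 C2 where "C1 \<in> K - {0}" "C2 \<in> K - {0}"
    "\<gamma> / \<alpha> = (\<sigma> C1 / C1) * (C2 / \<tau> C2)"
proof -
  interpret st: cyclic_action K "\<sigma> \<circ> \<tau>" n by (rule cyclic_action_comp)
  have "cyclic_norm n (\<sigma> \<circ> \<tau>) \<gamma> = cyclic_norm n \<tau> \<gamma>"
    unfolding cyclic_norm_def using \<gamma>
    by (intro prod.cong) (simp_all add: comp_funpow commute_funpow' funpow_fixed)
  moreover have "cyclic_norm n (\<sigma> \<circ> \<tau>) \<alpha> = cyclic_norm n \<sigma> \<alpha>"
    unfolding cyclic_norm_def using \<alpha> by (intro prod.cong) (simp_all add: comp_funpow funpow_fixed)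
  ultimately have "cyclic_norm n (\<sigma> \<circ> \<tau>) (\<gamma> / \<alpha>) = 1"
    using \<alpha> \<gamma> norm by (simp add: st.norm_divide)
  then obtain C where C: "C \<in> K" "C \<noteq> 0" "\<gamma> / \<alpha> = \<sigma> (\<tau> C) / C"
    using st.hilbert_90[of \<theta> \<zeta> "\<gamma> / \<alpha>"] eigen \<zeta> \<alpha> \<gamma> by auto
  show ?thesis
  proof (rule that[of "\<tau> C" "inverse C"])
    show "\<gamma> / \<alpha> = (\<sigma> (\<tau> C) / \<tau> C) * (inverse C / \<tau> (inverse C))"
      using C by (simp add: field_simps)
  qed (use C in auto)
qed

text \<open>
  Both \<open>\<sigma>(A)/A\<close> and \<open>\<sigma>(N\<^sub>\<tau> C1)/N\<^sub>\<tau> C1\<close> are equal to the norm of \<open>\<gamma>/\<alpha>\<close> along \<open>\<tau>\<close>; the factor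
  \<open>C2/\<tau> C2\<close> has norm \<open>1\<close> along \<open>\<tau>\<close>, and \<open>\<sigma>(A)/A\<close> is given by \<open>s.staircase_product\<close>.
\<close>

lemma norm_over_staircase_invariant:
  assumes \<alpha>: "\<alpha> \<in> K" "\<alpha> \<noteq> 0" "\<tau> \<alpha> = \<alpha>"
    and \<gamma>: "\<gamma> \<in> K" "cyclic_norm n \<tau> \<gamma> = cyclic_norm n \<sigma> \<alpha>"
    and C: "C1 \<in> K" "C1 \<noteq> 0" "C2 \<in> K" "C2 \<noteq> 0" "\<gamma> / \<alpha> = (\<sigma> C1 / C1) * (C2 / \<tau> C2)"
  defines "A \<equiv> \<Prod>i<n. (\<sigma> ^^ i) \<alpha> ^ (n - i - 1)"
  defines "f \<equiv> cyclic_norm n \<tau> C1 / A"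
  shows "A \<noteq> 0" "f \<in> K" "f \<noteq> 0" "\<sigma> f = f" "\<tau> f = f"
proof -
  have A: "A \<in> K" unfolding A_def using \<alpha> by (intro s.prod) simp
  have "(\<sigma> ^^ i) \<alpha> \<noteq> 0" for i
    using subfield_hom.hom_eq_0_iff[OF subfield_endo.axioms(1)[OF s.subfield_endo_funpow]] \<alpha> by auto
  then show A0: "A \<noteq> 0" by (simp add: A_def)
  show f: "f \<in> K" "f \<noteq> 0" using A A0 C by (simp_all add: f_def)
  have "\<tau> ((\<sigma> ^^ i) \<alpha>) = (\<sigma> ^^ i) \<alpha>" for i
    using commute_funpow[of \<alpha> i] \<alpha> by simp
  then have "\<tau> A = A"
    using \<alpha>(1) by (simp add: A_def t.hom_prod)
  then show "\<tau> f = f" using A C by (simp add: f_def)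
  have "\<sigma> A / A = cyclic_norm n \<sigma> \<alpha> / \<alpha> ^ n"
    using s.staircase_product[OF \<alpha>(1), folded A_def] A0 \<alpha>(2) by (simp add: field_simps)
  also have "\<dots> = cyclic_norm n \<tau> (\<gamma> / \<alpha>)"
    using \<alpha> \<gamma> s.pos by (simp add: t.norm_divide cyclic_norm_fixed)
  also have "\<dots> = cyclic_norm n \<tau> (\<sigma> C1) / cyclic_norm n \<tau> C1"
    unfolding C(5) using C by (simp add: t.norm_mult t.norm_divide)
  also have "cyclic_norm n \<tau> (\<sigma> C1) = \<sigma> (cyclic_norm n \<tau> C1)"
    using C by (intro t.norm_commute[symmetric] s.subfield_hom_axioms commute) auto
  finally show "\<sigma> f = f"
    using A A0 C by (simp add: f_def field_simps)
qed

end

lemma bicyclic_action_swap: "bicyclic_action K \<sigma> \<tau> n \<Longrightarrow> bicyclic_action K \<tau> \<sigma> n"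
  by (simp add: bicyclic_action_def bicyclic_action_axioms_def)


section \<open>The norm of a Kummer extension\<close>

text \<open>
  An embedding of \<open>F(r)\<close> over \<open>F\<close> sends \<open>r\<close> to a root \<open>\<zeta>\<^sup>k r\<close> of \<open>X\<^sup>p - r\<^sup>p\<close> and is determined
  by this value, so it agrees with a power of \<open>\<sigma>\<close>; the powers below \<open>p\<close> are distinguished by their
  values at \<open>r\<close>.
\<close>

lemma field_norm_kummer:
  fixes F :: "'k::field set"
  assumes act: "cyclic_action E \<sigma> p" "adjoin F {r} \<subseteq> E"
    and fixes_F: "\<And>x. x \<in> F \<Longrightarrow> \<sigma> x = x"
    and \<zeta>: "primitive_root p \<zeta>" "\<zeta> \<in> F"
    and r: "\<sigma> r = \<zeta> * r" "r \<noteq> 0" "r ^ p \<in> F"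
    and x: "x \<in> adjoin F {r}"
  shows "field_norm F (adjoin F {r}) x = cyclic_norm p \<sigma> x"
proof -
  interpret cyclic_action E \<sigma> p by fact
  let ?L = "adjoin F {r}"
  interpret L: type_subfield ?L by (rule type_subfield_adjoin)
  have FL: "F \<subseteq> ?L" and rL: "r \<in> ?L" using adjoin_superset[of F "{r}"] by auto
  have hom: "subfield_hom ?L (\<sigma> ^^ k)" for k
    using subfield_hom.restrict_to_subfield[OF _ type_subfield_adjoin act(2)]
      subfield_endo.axioms(1)[OF subfield_endo_funpow] by blast
  have fixes_F_funpow: "(\<sigma> ^^ k) y = y" if "y \<in> F" for k y
    using fixes_F[OF that] by (rule funpow_fixed)
  have orbit: "(\<sigma> ^^ k) r = \<zeta> ^ k * r" for k
  proof (induction k)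
    case (Suc k)
    have "\<zeta> ^ k \<in> E" "r \<in> E" using FL rL act(2) \<zeta>(2) by (auto intro!: power)
    then show ?case using Suc r(1) fixes_F[OF \<zeta>(2)] FL act(2) \<zeta>(2) by (auto simp: subset_iff)
  qed simp
  have emb: "embeddings F ?L = (\<lambda>k. restrict (\<sigma> ^^ k) ?L) ` {..<p}"
  proof (intro equalityI subsetI)
    fix \<rho> assume \<rho>: "\<rho> \<in> embeddings F ?L"
    interpret \<rho>: subfield_hom ?L \<rho> using embeddingsD(1)[OF \<rho> type_subfield_adjoin] .
    have "\<rho> r ^ p = r ^ p"
      using embeddingsD(2)[OF \<rho> type_subfield_adjoin r(3)] rL by simp
    then have "(\<rho> r / r) ^ p = 1" using r(2) by (simp add: power_divide)
    then obtain k where k: "k < p" "\<rho> r / r = \<zeta> ^ k"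
      by (rule primitive_root_powers_exhaust[OF \<zeta>(1)])
    have "\<rho> y = (\<sigma> ^^ k) y" if "y \<in> ?L" for y
    proof (rule subfield_homs_agree_on_adjoin[OF \<rho>.subfield_hom_axioms hom adjoin_superset _ that])
      fix z assume "z \<in> F \<union> {r}"
      then show "\<rho> z = (\<sigma> ^^ k) z"
        using embeddingsD(2)[OF \<rho> type_subfield_adjoin] fixes_F_funpow orbit k(2) r(2)
        by (auto simp: field_simps)
    qed
    then have "\<rho> = restrict (\<sigma> ^^ k) ?L"
      using embeddingsD(3)[OF \<rho> type_subfield_adjoin] by (auto intro!: extensionalityI)
    then show "\<rho> \<in> (\<lambda>k. restrict (\<sigma> ^^ k) ?L) ` {..<p}" using k(1) by blast
  next
    fix \<rho> assume "\<rho> \<in> (\<lambda>k. restrict (\<sigma> ^^ k) ?L) ` {..<p}"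
    then show "\<rho> \<in> embeddings F ?L"
      using hom fixes_F_funpow FL by (auto intro!: embeddingsI)
  qed
  have "inj_on (\<lambda>k. restrict (\<sigma> ^^ k) ?L) {..<p}"
  proof (rule inj_onI)
    fix i j assume ij: "i \<in> {..<p}" "j \<in> {..<p}"
      and "restrict (\<sigma> ^^ i) ?L = restrict (\<sigma> ^^ j) ?L"
    then have "(\<sigma> ^^ i) r = (\<sigma> ^^ j) r" using rL by (metis restrict_apply')
    then have "\<zeta> ^ i = \<zeta> ^ j" using r(2) by (simp add: orbit)
    then show "i = j" using inj_on_primitive_root_powers[OF \<zeta>(1)] ij by (auto dest: inj_onD)
  qed
  then show ?thesis
    using x by (simp add: field_norm_def emb prod.reindex cyclic_norm_lessThan pos)
qed


section \<open>Galois groups of adjunctions\<close>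

lemma galois_groupD:
  assumes "\<sigma> \<in> carrier (galois_group F (adjoin F S))"
  shows "subfield_endo (adjoin F S) \<sigma>" and "\<And>x. x \<in> F \<Longrightarrow> \<sigma> x = x"
proof -
  have emb: "\<sigma> \<in> embeddings F (adjoin F S)" and "bij_betw \<sigma> (adjoin F S) (adjoin F S)"
    using assms by (auto simp: galois_group_def Bij_def)
  then show "subfield_endo (adjoin F S) \<sigma>"
    using embeddingsD(1)[OF emb type_subfield_adjoin]
    by (auto simp: bij_betw_def intro!: subfield_endo.intro subfield_endo_axioms.intro)
  show "\<sigma> x = x" if "x \<in> F" for x
    using embeddingsD(2)[OF emb type_subfield_adjoin] that by blast
qed

lemma subfield_hom_id: "type_subfield K \<Longrightarrow> subfield_hom K (\<lambda>x. x)"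
  by (simp add: subfield_hom_def subfield_hom_axioms_def)

lemma galois_cyclic_action:
  assumes "\<sigma> \<in> carrier (galois_group F (adjoin F S))" "n > 0"
    and "\<And>s. s \<in> S \<Longrightarrow> (\<sigma> ^^ n) s = s"
  shows "cyclic_action (adjoin F S) \<sigma> n"
proof -
  interpret subfield_endo "adjoin F S" \<sigma> using galois_groupD(1)[OF assms(1)] .
  show ?thesis
  proof
    fix x assume "x \<in> adjoin F S"
    then show "(\<sigma> ^^ n) x = x"
      using subfield_homs_agree_on_adjoin[OF
          subfield_endo.axioms(1)[OF subfield_endo_funpow, of n]
          subfield_hom_id[OF type_subfield_axioms] adjoin_superset, of x]
        assms(3) funpow_fixed[of \<sigma>, OF galois_groupD(2)[OF assms(1)]] by blast
  qed fact
qed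

lemma galois_funpow_eigenvector:
  assumes "\<sigma> \<in> carrier (galois_group F (adjoin F S))" "\<zeta> \<in> F" "s \<in> S" "\<sigma> s = \<zeta> * s"
  shows "(\<sigma> ^^ k) s = \<zeta> ^ k * s"
proof (induction k)
  case (Suc k)
  interpret subfield_endo "adjoin F S" \<sigma> using galois_groupD(1)[OF assms(1)] .
  have "\<zeta> \<in> adjoin F S" "s \<in> adjoin F S" using adjoin_superset[of F S] assms(2,3) by auto
  then show ?case
    using Suc galois_groupD(2)[OF assms(1,2)] assms(4) by simp
qed simp

text \<open>
  Descend the tower \<open>F \<subseteq> F(ra) \<subseteq> F(ra, rc)\<close>: each step is a simple Kummer extension, with \<open>\<tau>\<close>
  acting on the upper one and \<open>\<sigma>\<close> on the lower one.
\<close>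

lemma bicyclic_kummer_fixed_field:
  fixes ra rc :: "'a::field alg_closure"
  defines "E \<equiv> adjoin base_field {ra, rc}"
  assumes \<zeta>: "primitive_root p \<zeta>" "prime p" "\<zeta> \<in> base_field"
    and pow: "ra ^ p \<in> base_field" "rc ^ p \<in> base_field"
    and \<sigma>: "\<sigma> \<in> carrier (galois_group base_field E)" "\<sigma> ra = \<zeta> * ra"
    and \<tau>: "\<tau> \<in> carrier (galois_group base_field E)" "\<tau> rc = \<zeta> * rc" "\<tau> ra = ra"
    and x: "x \<in> E" "\<sigma> x = x" "\<tau> x = x"
  shows "x \<in> base_field"
proof -
  interpret s: subfield_endo E \<sigma> using galois_groupD(1) \<sigma>(1) unfolding E_def .
  interpret t: subfield_endo E \<tau> using galois_groupD(1) \<tau>(1) unfolding E_def .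
  have \<sigma>_base: "\<sigma> y = y" if "y \<in> base_field" for y
    using galois_groupD(2) \<sigma>(1) that unfolding E_def by blast
  have \<tau>_base: "\<tau> y = y" if "y \<in> base_field" for y
    using galois_groupD(2) \<tau>(1) that unfolding E_def by blast
  let ?Ka = "adjoin base_field {ra}"
  have gens: "base_field \<union> {ra, rc} \<subseteq> E"
    unfolding E_def by (rule adjoin_superset)
  have KaE: "?Ka \<subseteq> E"
    using gens by (intro adjoin_least s.type_subfield_axioms) auto
  have "base_field \<union> {ra, rc} \<subseteq> adjoin ?Ka {rc}"
    using adjoin_superset[of base_field "{ra}"] adjoin_superset[of ?Ka "{rc}"] by blast
  then have E_tower: "E \<subseteq> adjoin ?Ka {rc}"
    unfolding E_def by (rule adjoin_least[OF type_subfield_adjoin])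
  have tower_E: "adjoin ?Ka {rc} \<subseteq> E"
    using gens KaE by (intro adjoin_least s.type_subfield_axioms) auto
  have base_Ka: "base_field \<subseteq> ?Ka" using adjoin_superset[of base_field "{ra}"] by blast
  have \<tau>_Ka: "\<tau> y = y" if "y \<in> ?Ka" for y
    by (rule subfield_homs_agree_on_adjoin[OF t.subfield_hom_axioms
          subfield_hom_id[OF s.type_subfield_axioms] _ _ that])
       (use gens \<tau>_base \<tau>(3) in auto)
  have x_Ka: "x \<in> ?Ka"
    by (rule kummer_fixed_field[OF type_subfield_adjoin base_Ka t.subfield_hom_axioms tower_E
          \<tau>_Ka \<zeta>(1,2) _ \<tau>(2)])
       (use base_Ka \<zeta>(3) pow(2) E_tower x in auto)
  show ?thesis
    by (rule kummer_fixed_field[OF type_subfield_base_field order_refl s.subfield_hom_axioms KaE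
          \<sigma>_base \<zeta> \<sigma>(2) pow(1) x_Ka x(2)])
qed


section \<open>Coboundaries from elements of equal norm\<close>

theorem theorem4p12:
  fixes p :: nat
    and \<xi> a b c :: "'a::field"
    and ra rc \<alpha> \<gamma> A0 B C0 :: "'a alg_closure"
    and E :: "'a alg_closure set"
    and \<sigma>a \<sigma>c :: "'a alg_closure \<Rightarrow> 'a alg_closure"
  assumes "prime p"
    and "\<xi> ^ p = 1" and "\<forall>k. 0 < k \<and> k < p \<longrightarrow> \<xi> ^ k \<noteq> 1"
    and "a \<noteq> 0" and "b \<noteq> 0" and "c \<noteq> 0"
    and "kummer_cup_vanishes p \<xi> a b" and "kummer_cup_vanishes p \<xi> b c"
    and "lin_indep_mod_powers p a c" and "lin_indep_mod_powers p a b"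
    and "ra ^ p = to_ac a" and "rc ^ p = to_ac c"
    and "E = adjoin base_field {ra, rc}"
    and "\<sigma>a \<in> carrier (galois_group base_field E)"
    and "\<sigma>a ra = to_ac \<xi> * ra" and "\<sigma>a rc = rc"
    and "\<sigma>c \<in> carrier (galois_group base_field E)"
    and "\<sigma>c rc = to_ac \<xi> * rc" and "\<sigma>c ra = ra"
    and "\<alpha> \<in> adjoin base_field {ra}" and "\<gamma> \<in> adjoin base_field {rc}"
    and "field_norm base_field (adjoin base_field {ra}) \<alpha> = to_ac b"
    and "field_norm base_field (adjoin base_field {rc}) \<gamma> = to_ac b"
    and "A0 = (\<Prod>i=0..p-2. (\<sigma>a ^^ i) (\<alpha> ^ (p - i - 1)))"
    and "C0 = (\<Prod>i=0..p-2. (\<sigma>c ^^ i) (\<gamma> ^ (p - i - 1)))"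
    and "B = \<gamma> / \<alpha>"
  shows "\<exists>fa fc :: 'a. fa \<noteq> 0 \<and> fc \<noteq> 0 \<and>
           (to_ac fa * A0, B, to_ac fc * C0) \<in> bicyclic_B2 p E \<sigma>a \<sigma>c"
proof -
  note p = assms(1) and \<sigma>a = assms(14-16) and \<sigma>c = assms(17-19)
  define \<zeta> where "\<zeta> = to_ac \<xi>"
  define F where "F = (base_field :: 'a alg_closure set)"
  have p_pos: "p > 0" using p by (rule prime_gt_0_nat)
  have \<zeta>: "primitive_root p \<zeta>" "\<zeta> \<in> F"
    using assms(2,3) p_pos unfolding primitive_root_def \<zeta>_def F_def
    by (auto simp flip: to_ac_power)
  have roots: "ra ^ p \<in> F" "rc ^ p \<in> F" "ra \<noteq> 0" "rc \<noteq> 0"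
    using assms(4,6,11,12) p_pos by (auto simp: F_def power_0_left)
  note E = assms(13)[folded F_def]
  note gal_a = \<sigma>a(1)[folded F_def, unfolded E] and gal_c = \<sigma>c(1)[folded F_def, unfolded E]
  have gens: "F \<union> {ra, rc} \<subseteq> E" unfolding E by (rule adjoin_superset)
  have orbit_a: "(\<sigma>a ^^ k) ra = \<zeta> ^ k * ra" for k
    using galois_funpow_eigenvector[OF gal_a \<zeta>(2)] \<sigma>a(2) by (simp add: \<zeta>_def)
  have orbit_c: "(\<sigma>c ^^ k) rc = \<zeta> ^ k * rc" for k
    using galois_funpow_eigenvector[OF gal_c \<zeta>(2)] \<sigma>c(2) by (simp add: \<zeta>_def)
  interpret s: cyclic_action E \<sigma>a p
    unfolding E using gal_a p_pos orbit_a \<sigma>a(3) \<zeta>(1)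
    by (intro galois_cyclic_action) (auto simp: funpow_fixed primitive_root_def)
  interpret t: cyclic_action E \<sigma>c p
    unfolding E using gal_c p_pos orbit_c \<sigma>c(3) \<zeta>(1)
    by (intro galois_cyclic_action) (auto simp: funpow_fixed primitive_root_def)
  have base_a: "\<sigma>a x = x" and base_c: "\<sigma>c x = x" if "x \<in> F" for x
    using galois_groupD(2)[OF gal_a] galois_groupD(2)[OF gal_c] that by auto
  have \<zeta>E: "\<zeta> \<in> E" using gens \<zeta>(2) by blast

  have commute: "\<sigma>a (\<sigma>c x) = \<sigma>c (\<sigma>a x)" if "x \<in> E" for x
  proof -
    have "subfield_hom E (\<sigma>a \<circ> \<sigma>c)" "subfield_hom E (\<sigma>c \<circ> \<sigma>a)"
      using subfield_endo_comp s.subfield_endo_axioms t.subfield_endo_axioms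
      by (blast dest: subfield_endo.axioms(1))+
    then have "(\<sigma>a \<circ> \<sigma>c) x = (\<sigma>c \<circ> \<sigma>a) x"
      by (rule subfield_homs_agree_on_adjoin[OF _ _ gens _ that[unfolded E]])
         (use \<sigma>a \<sigma>c base_a base_c gens \<zeta> \<zeta>E in \<open>auto simp: \<zeta>_def\<close>)
    then show ?thesis by simp
  qed
  interpret bicyclic_action E \<sigma>a \<sigma>c p by unfold_locales (rule commute)
  interpret swap: bicyclic_action E \<sigma>c \<sigma>a p
    by (rule bicyclic_action_swap) (rule bicyclic_action_axioms)

  have sub_a: "adjoin F {ra} \<subseteq> E" and sub_c: "adjoin F {rc} \<subseteq> E"
    by (rule adjoin_least[OF s.type_subfield_axioms], use gens in blast)+
  have \<alpha>E: "\<alpha> \<in> E" and \<gamma>E: "\<gamma> \<in> E"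
    using assms(20,21) sub_a sub_c by (auto simp: F_def)
  have id: "subfield_hom E (\<lambda>x. x)" by (rule subfield_hom_id) (rule s.type_subfield_axioms)
  have \<alpha>_fixed: "\<sigma>c \<alpha> = \<alpha>"
    by (rule subfield_homs_agree_on_adjoin[OF t.subfield_hom_axioms id _ _ assms(20)])
       (use gens base_c \<sigma>c(3) in \<open>auto simp: F_def\<close>)
  have \<gamma>_fixed: "\<sigma>a \<gamma> = \<gamma>"
    by (rule subfield_homs_agree_on_adjoin[OF s.subfield_hom_axioms id _ _ assms(21)])
       (use gens base_a \<sigma>a(3) in \<open>auto simp: F_def\<close>)
  have norm_\<alpha>: "cyclic_norm p \<sigma>a \<alpha> = to_ac b"
    using field_norm_kummer[OF s.cyclic_action_axioms sub_a base_a \<zeta>, of \<alpha>]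
      assms(20,22) \<sigma>a(2) roots by (simp add: F_def \<zeta>_def)
  have norm_\<gamma>: "cyclic_norm p \<sigma>c \<gamma> = to_ac b"
    using field_norm_kummer[OF t.cyclic_action_axioms sub_c base_c \<zeta>, of \<gamma>]
      assms(21,23) \<sigma>c(2) roots by (simp add: F_def \<zeta>_def)
  have nz: "\<alpha> \<noteq> 0" "\<gamma> \<noteq> 0"
    using s.norm_eq_0_iff[OF \<alpha>E] t.norm_eq_0_iff[OF \<gamma>E] norm_\<alpha> norm_\<gamma> assms(5) by auto

  \<comment> \<open>The generator \<open>ra\<close> is an eigenvector of the diagonal element \<open>\<sigma>a\<sigma>c\<close>.\<close>
  have "\<sigma>a (\<sigma>c ra) = \<zeta> * ra" using \<sigma>a(2) \<sigma>c(3) by (simp add: \<zeta>_def)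
  then obtain C1 C2 where C: "C1 \<in> E - {0}" "C2 \<in> E - {0}"
    and boundary: "\<gamma> / \<alpha> = (\<sigma>a C1 / C1) * (C2 / \<sigma>c C2)"
    using norm_quotient_is_boundary[OF _ roots(3) _ \<zeta>(1) \<zeta>E base_a[OF \<zeta>(2)] base_c[OF \<zeta>(2)]
        \<alpha>E nz(1) \<alpha>_fixed \<gamma>E nz(2) \<gamma>_fixed trans[OF norm_\<gamma> norm_\<alpha>[symmetric]]] gens
    by blast
  have C': "C1 \<in> E" "C1 \<noteq> 0" "C2 \<in> E" "C2 \<noteq> 0" using C by auto
  have boundary': "\<alpha> / \<gamma> = (\<sigma>c C2 / C2) * (C1 / \<sigma>a C1)"
    using arg_cong[OF boundary, of inverse] by (simp add: mult.commute)

  \<comment> \<open>The extra factor at \<open>i = p - 1\<close> has exponent \<open>0\<close>.\<close>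
  have staircase: "(\<Prod>i=0..p-2. (\<sigma> ^^ i) (x ^ (p - i - 1))) = (\<Prod>i<p. (\<sigma> ^^ i) x ^ (p - i - 1))"
    if "subfield_endo E \<sigma>" "x \<in> E" for \<sigma> x
  proof -
    have "(\<sigma> ^^ i) (x ^ k) = (\<sigma> ^^ i) x ^ k" for i k
      using subfield_endo.subfield_endo_funpow[OF that(1)] that(2)
      by (intro subfield_hom.hom_power subfield_endo.axioms(1))
    moreover have "{..<p} = insert (p - 1) {0..p-2}"
      using prime_gt_1_nat[OF p] by auto
    ultimately show ?thesis
      using prime_gt_1_nat[OF p] by (cases "p - 1 \<in> {0..p-2}") (auto simp: insert_absorb)
  qed
  have A0: "A0 = (\<Prod>i<p. (\<sigma>a ^^ i) \<alpha> ^ (p - i - 1))"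
    unfolding assms(24) by (rule staircase[OF s.subfield_endo_axioms \<alpha>E])
  have C0: "C0 = (\<Prod>i<p. (\<sigma>c ^^ i) \<gamma> ^ (p - i - 1))"
    unfolding assms(25) by (rule staircase[OF t.subfield_endo_axioms \<gamma>E])

  have fa: "A0 \<noteq> 0" "cyclic_norm p \<sigma>c C1 / A0 \<in> E" "cyclic_norm p \<sigma>c C1 / A0 \<noteq> 0"
    "\<sigma>a (cyclic_norm p \<sigma>c C1 / A0) = cyclic_norm p \<sigma>c C1 / A0"
    "\<sigma>c (cyclic_norm p \<sigma>c C1 / A0) = cyclic_norm p \<sigma>c C1 / A0"
    unfolding A0
    by (rule norm_over_staircase_invariant[OF \<alpha>E nz(1) \<alpha>_fixed \<gamma>E
          trans[OF norm_\<gamma> norm_\<alpha>[symmetric]] C' boundary])+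
  have fc: "C0 \<noteq> 0" "cyclic_norm p \<sigma>a C2 / C0 \<in> E" "cyclic_norm p \<sigma>a C2 / C0 \<noteq> 0"
    "\<sigma>a (cyclic_norm p \<sigma>a C2 / C0) = cyclic_norm p \<sigma>a C2 / C0"
    "\<sigma>c (cyclic_norm p \<sigma>a C2 / C0) = cyclic_norm p \<sigma>a C2 / C0"
    unfolding C0
    by (rule swap.norm_over_staircase_invariant[OF \<gamma>E nz(2) \<gamma>_fixed \<alpha>E
          trans[OF norm_\<alpha> norm_\<gamma>[symmetric]] C'(3,4,1,2) boundary'])+
  have fixed: "x \<in> base_field" if "x \<in> E" "\<sigma>a x = x" "\<sigma>c x = x" for x
    using bicyclic_kummer_fixed_field[of p \<zeta> ra rc \<sigma>a \<sigma>c x] that p \<zeta> roots(1,2) \<sigma>a \<sigma>c E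
    by (simp add: F_def \<zeta>_def)
  obtain fa' where fa': "cyclic_norm p \<sigma>c C1 / A0 = to_ac fa'"
    using fixed[OF fa(2,4,5)] by blast
  obtain fc' where fc': "cyclic_norm p \<sigma>a C2 / C0 = to_ac fc'"
    using fixed[OF fc(2,4,5)] by blast
  have eqs: "to_ac fa' * A0 = cyclic_norm p \<sigma>c C1" "to_ac fc' * C0 = cyclic_norm p \<sigma>a C2"
    using fa(1) fc(1) by (simp_all flip: fa' fc')
  have "(to_ac fa' * A0, B, to_ac fc' * C0) \<in> bicyclic_B2 p E \<sigma>a \<sigma>c"
    unfolding bicyclic_B2_def eqs assms(26) mem_Collect_eq case_prod_conv
    using C C' nz \<alpha>E \<gamma>E by (intro conjI bexI[OF _ C(1)] bexI[OF _ C(2)] refl boundary) auto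
  moreover have "fa' \<noteq> 0" "fc' \<noteq> 0"
    using fa(3)[unfolded fa'] fc(3)[unfolded fc'] by auto
  ultimately show ?thesis by blast
qed

end
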